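(* Every reflection group $G$ whose cardinality does not exceed the cardinality of the continuum is natural.
   Context: A group $(G,* )$ is called natural if there exists a metric $d$ on the underlying set $G$ such that (i) every right translation $R_g: x \mapsto x*g$, $g \in G$, is an isometry of $(G,d)$, and (ii) whenever $(G,\circ)$ is any group structure on the same set $G$ all of whose right translations are isometries of $(G,d)$, then $(G,\circ)$ is isomorphic to $(G,* )$ as an abstract group. A reflection means an involution, i.e. an element $s \in G$ of order $2$. A subset $S \subset G$ generates $G$ if every $g \in G$ can be written as a finite product $g = s_1 s_2 \cdots s_n$ with $s_k \in S$. A group $G$ is called a reflection group if it is generated by a (possibly infinite) subset $S$ of $G$ all of whose elements are reflections. *)

theory Defs
  imports
    "HOL-Analysis.Abstract_Metric_Spaces"
    "HOL-Algebra.Multiplicative_Group"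
    "HOL-Library.Equipollence"
begin

definition isometry_on :: "'a set \<Rightarrow> ('a \<Rightarrow> 'a \<Rightarrow> real) \<Rightarrow> ('a \<Rightarrow> 'a) \<Rightarrow> bool"
  where "isometry_on M d f \<longleftrightarrow>
    bij_betw f M M \<and> (\<forall>x\<in>M. \<forall>y\<in>M. d (f x) (f y) = d x y)"

definition right_translations_isometric :: "('a, 'b) monoid_scheme \<Rightarrow> ('a \<Rightarrow> 'a \<Rightarrow> real) \<Rightarrow> bool"
  where "right_translations_isometric G d \<longleftrightarrow>
    (\<forall>g\<in>carrier G. isometry_on (carrier G) d (\<lambda>x. x \<otimes>\<^bsub>G\<^esub> g))"

text \<open>
  The structures \<open>H\<close> are all group structures on the underlying set of \<open>G\<close>; their unit need not
  be that of \<open>G\<close>, and the isomorphism need not respect the metric.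
\<close>

definition natural_group :: "('a, 'b) monoid_scheme \<Rightarrow> bool"
  where "natural_group G \<longleftrightarrow> group G \<and>
    (\<exists>d. Metric_space (carrier G) d \<and> right_translations_isometric G d \<and>
      (\<forall>H :: 'a monoid.
        group H \<and> carrier H = carrier G \<and> right_translations_isometric H d \<longrightarrow> H \<cong> G))"

definition reflection :: "('a, 'b) monoid_scheme \<Rightarrow> 'a \<Rightarrow> bool"
  where "reflection G s \<longleftrightarrow> s \<in> carrier G \<and> group.ord G s = 2"

text \<open>
  Generation by finite products without inverses, so this differs in general from \<^const>\<open>generate\<close>.
  The empty product is allowed, which only matters for \<open>S = {}\<close> when \<open>S\<close> consists of reflections;
  the trivial group is thus a reflection group.
\<close>

definition generated_by_products :: "('a, 'b) monoid_scheme \<Rightarrow> 'a set \<Rightarrow> bool"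
  where "generated_by_products G S \<longleftrightarrow>
    (\<forall>g\<in>carrier G. \<exists>ss. set ss \<subseteq> S \<and> g = foldr (\<otimes>\<^bsub>G\<^esub>) ss \<one>\<^bsub>G\<^esub>)"

definition reflection_group :: "('a, 'b) monoid_scheme \<Rightarrow> bool"
  where "reflection_group G \<longleftrightarrow> group G \<and>
    (\<exists>S \<subseteq> carrier G. (\<forall>s\<in>S. reflection G s) \<and> generated_by_products G S)"

end

theory Submission
  imports Defs
begin

text \<open>
  Right translations preserve the quotient \<open>x \<otimes> inv y\<close> of two elements, and exchanging \<open>x\<close> and
  \<open>y\<close> inverts it. If \<open>G\<close> has at most continuum many elements, there is enough room in \<open>[1, 2]\<close> to
  use a different number for each pair \<open>{g, inv g}\<close>, and the number of the pair of
  \<open>x \<otimes> inv y\<close> is then a right-invariant distance between distinct points \<open>x\<close> and \<open>y\<close>; the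
  triangle inequality holds because every nonzero distance lies in \<open>[1, 2]\<close>.

  An isometry \<open>\<phi>\<close> of this metric can change a quotient only to its inverse. For a reflection
  \<open>s = inv s\<close> there is no ambiguity left: \<open>\<phi> (s \<otimes> y) = s \<otimes> \<phi> y\<close>. Since the reflections
  generate \<open>G\<close>, the map \<open>\<phi>\<close> commutes with all left translations, and hence is a right
  translation (\<open>equivariant_imp_right_translation\<close>). So right translations are the only
  isometries. If \<open>H\<close> is another group structure with isometric right translations, each of them
  is a right translation of \<open>G\<close>, and this correspondence is the required isomorphism
  (\<open>iso_of_common_right_translations\<close>).
\<close>

text \<open>
  The larger of the two values that an injective function takes on \<open>g\<close> and \<open>inv g\<close> is a symmetric
  function of them that still determines the pair. The function \<open>arctan\<close> serves to squeeze the
  real line into an interval inside \<open>[1, 2]\<close>.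
\<close>

lemma (in group) ex_inversion_separating_function:
  assumes "carrier G \<lesssim> (UNIV :: real set)"
  obtains f :: "'a \<Rightarrow> real"
  where "\<And>g. 1 \<le> f g" "\<And>g. f g \<le> 2"
    and "\<And>g. g \<in> carrier G \<Longrightarrow> f (inv g) = f g"
    and "\<And>g h. \<lbrakk>g \<in> carrier G; h \<in> carrier G; f g = f h\<rbrakk> \<Longrightarrow> g = h \<or> g = inv h"
proof -
  from assms obtain e :: "'a \<Rightarrow> real" where e: "inj_on e (carrier G)"
    by (auto simp: lepoll_def)
  define u where "u g = 3/2 + arctan (e g) / 4" for g
  have u_bounds: "1 \<le> u g" "u g \<le> 2" for g
    using arctan_bounded[of "e g"] pi_less_4 by (auto simp: u_def)
  have u_inj: "g = h" if "g \<in> carrier G" "h \<in> carrier G" "u g = u h" for g h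
    using that inj_onD[OF e] by (auto simp: u_def arctan_eq_iff)
  show thesis
  proof (rule that[of "\<lambda>g. max (u g) (u (inv g))"])
    fix g h
    assume gh: "g \<in> carrier G" "h \<in> carrier G" "max (u g) (u (inv g)) = max (u h) (u (inv h))"
    then consider "u g = u h" | "u g = u (inv h)" | "u (inv g) = u h" | "u (inv g) = u (inv h)"
      by (auto simp: max_def split: if_splits)
    then show "g = h \<or> g = inv h"
      using gh(1,2) u_inj[of g h] u_inj[of g "inv h"] u_inj[of "inv g" h] u_inj[of "inv g" "inv h"]
      by cases (auto simp: inv_inv)
  qed (auto simp: u_bounds max.commute le_max_iff_disj)
qed

lemma Metric_space_if_values_between_1_and_2:
  fixes w :: "'a \<Rightarrow> 'a \<Rightarrow> real"
  assumes lower: "\<And>x y. 1 \<le> w x y" and upper: "\<And>x y. w x y \<le> 2"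
    and sym: "\<And>x y. w x y = w y x"
  shows "Metric_space M (\<lambda>x y. if x = y then 0 else w x y)"
proof
  fix x y z
  show "0 \<le> (if x = y then 0 else w x y)"
    using lower[of x y] by simp
  show "(if x = y then 0 else w x y) = (if y = x then 0 else w y x)"
    using sym by simp
  show "(if x = y then 0 else w x y) = 0 \<longleftrightarrow> x = y"
    using lower[of x y] by simp
  show "(if x = z then 0 else w x z) \<le> (if x = y then 0 else w x y) + (if y = z then 0 else w y z)"
    using lower[of x y] lower[of y z] upper[of x z] by auto
qed

text \<open>
  Commuting with left multiplication by generators means commuting with all left
  multiplications, and such a map is determined by its value at \<open>\<one>\<close>.
\<close>

lemma (in group) equivariant_imp_right_translation:
  assumes gen: "generated_by_products G S" and S: "S \<subseteq> carrier G"
    and \<phi>: "\<phi> \<in> carrier G \<rightarrow> carrier G"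
    and eq: "\<And>s y. s \<in> S \<Longrightarrow> y \<in> carrier G \<Longrightarrow> \<phi> (s \<otimes> y) = s \<otimes> \<phi> y"
    and x: "x \<in> carrier G"
  shows "\<phi> x = x \<otimes> \<phi> \<one>"
proof -
  have "foldr (\<otimes>) ss \<one> \<in> carrier G \<and> \<phi> (foldr (\<otimes>) ss \<one>) = foldr (\<otimes>) ss \<one> \<otimes> \<phi> \<one>"
    if "set ss \<subseteq> S" for ss
    using that
  proof (induction ss)
    case Nil
    have "\<phi> \<one> \<in> carrier G" using \<phi> by auto
    then show ?case by simp
  next
    case (Cons s ss)
    then show ?case using S \<phi> by (auto simp: eq m_assoc Pi_iff)
  qed
  with gen x show ?thesis
    unfolding generated_by_products_def by metis
qed

text \<open>
  The translation by \<open>h\<close> in \<open>H\<close> sends the unit of \<open>G\<close> to \<open>\<one> \<otimes>\<^bsub>H\<^esub> h\<close>, so this must be the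
  element by which it translates in \<open>G\<close>. As the unit of \<open>G\<close> need not be that of \<open>H\<close>, the
  isomorphism is in general not the identity map.
\<close>

lemma iso_of_common_right_translations:
  assumes "group G" "group H" and carrier: "carrier H = carrier G"
    and trans: "\<And>x h. x \<in> carrier G \<Longrightarrow> h \<in> carrier G \<Longrightarrow>
      x \<otimes>\<^bsub>H\<^esub> h = x \<otimes>\<^bsub>G\<^esub> (\<one>\<^bsub>G\<^esub> \<otimes>\<^bsub>H\<^esub> h)"
  shows "(\<lambda>h. \<one>\<^bsub>G\<^esub> \<otimes>\<^bsub>H\<^esub> h) \<in> iso H G"
proof -
  interpret G: group G by fact
  interpret H: group H by fact
  have one: "\<one>\<^bsub>G\<^esub> \<in> carrier H" by (simp add: carrier)
  have closed: "x \<otimes>\<^bsub>H\<^esub> y \<in> carrier G" if "x \<in> carrier G" "y \<in> carrier G" for x y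
    using H.m_closed that by (simp add: carrier)
  have "\<one>\<^bsub>G\<^esub> \<otimes>\<^bsub>H\<^esub> (h \<otimes>\<^bsub>H\<^esub> k) = (\<one>\<^bsub>G\<^esub> \<otimes>\<^bsub>H\<^esub> h) \<otimes>\<^bsub>G\<^esub> (\<one>\<^bsub>G\<^esub> \<otimes>\<^bsub>H\<^esub> k)"
    if "h \<in> carrier G" "k \<in> carrier G" for h k
    using H.m_assoc[OF one, of h k] trans[of "\<one>\<^bsub>G\<^esub> \<otimes>\<^bsub>H\<^esub> h" k] that closed
    by (simp add: carrier)
  moreover have "bij_betw (\<lambda>h. \<one>\<^bsub>G\<^esub> \<otimes>\<^bsub>H\<^esub> h) (carrier H) (carrier H)"
    by (rule bij_betw_byWitness[where f' = "\<lambda>h. inv\<^bsub>H\<^esub> \<one>\<^bsub>G\<^esub> \<otimes>\<^bsub>H\<^esub> h"])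
      (use one in \<open>auto simp flip: H.m_assoc\<close>)
  ultimately show ?thesis
    using closed by (auto simp: iso_def hom_def carrier)
qed

lemma (in group) natural_if_generated_by_reflections:
  assumes small: "carrier G \<lesssim> (UNIV :: real set)"
    and S: "S \<subseteq> carrier G" "\<And>s. s \<in> S \<Longrightarrow> reflection G s"
    and gen: "generated_by_products G S"
  shows "natural_group G"
proof -
  obtain f :: "'a \<Rightarrow> real"
    where f_bounds: "\<And>g. 1 \<le> f g" "\<And>g. f g \<le> 2"
      and f_inv: "\<And>g. g \<in> carrier G \<Longrightarrow> f (inv g) = f g"
      and f_sep: "\<And>g h. \<lbrakk>g \<in> carrier G; h \<in> carrier G; f g = f h\<rbrakk> \<Longrightarrow> g = h \<or> g = inv h"
    using ex_inversion_separating_function[OF small] by blast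
  \<comment> \<open>The symmetry axiom of a metric space ranges over the whole type, where \<open>inv\<close> is unspecified;
    any constant in \<open>[1, 2]\<close> will do outside the carrier.\<close>
  define w where "w x y = (if x \<in> carrier G \<and> y \<in> carrier G then f (x \<otimes> inv y) else 1)" for x y
  define d where "d x y = (if x = y then 0 else w x y)" for x y

  have "w x y = w y x" for x y
    using f_inv[of "x \<otimes> inv y"] by (auto simp: w_def inv_mult_group)
  moreover have "1 \<le> w x y" "w x y \<le> 2" for x y
    using f_bounds by (auto simp: w_def)
  ultimately have metric: "Metric_space (carrier G) d"
    unfolding d_def by (intro Metric_space_if_values_between_1_and_2)

  have isometric: "right_translations_isometric G d"
  proof -
    have "bij_betw (\<lambda>x. x \<otimes> g) (carrier G) (carrier G)" if g: "g \<in> carrier G" for g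
      by (rule bij_betw_byWitness[where f' = "\<lambda>x. x \<otimes> inv g"]) (use g in \<open>auto simp: m_assoc\<close>)
    moreover have "d (x \<otimes> g) (y \<otimes> g) = d x y"
      if "x \<in> carrier G" "y \<in> carrier G" "g \<in> carrier G" for x y g
    proof -
      have "(x \<otimes> g) \<otimes> inv (y \<otimes> g) = x \<otimes> (g \<otimes> inv g) \<otimes> inv y"
        using that by (simp only: inv_mult_group m_assoc m_closed inv_closed)
      with that show ?thesis by (simp add: d_def w_def)
    qed
    ultimately show ?thesis
      by (simp add: right_translations_isometric_def isometry_on_def)
  qed

  have rigid: "\<phi> x = x \<otimes> \<phi> \<one>" if \<phi>: "isometry_on (carrier G) d \<phi>" and x: "x \<in> carrier G" for \<phi> x
  proof (rule equivariant_imp_right_translation[OF gen S(1) _ _ x])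
    show closed: "\<phi> \<in> carrier G \<rightarrow> carrier G"
      using \<phi> by (auto simp: isometry_on_def bij_betw_def)
    fix s y assume s: "s \<in> S" and y: "y \<in> carrier G"
    have sG: "s \<in> carrier G" and ord: "ord s = 2"
      using s S by (auto simp: reflection_def)
    have "s \<otimes> s = \<one>"
      using pow_ord_eq_1[OF sG] sG by (simp add: ord numeral_2_eq_2)
    then have inv_s: "inv s = s"
      using sG by (simp add: inv_equality)
    have "s \<noteq> \<one>" using ord by auto
    then have sy: "s \<otimes> y \<noteq> y" using sG y by simp
    have img: "\<phi> (s \<otimes> y) \<in> carrier G" "\<phi> y \<in> carrier G"
      using closed sG y by auto
    have "\<phi> (s \<otimes> y) \<noteq> \<phi> y"
      using \<phi> sy inj_on_eq_iff[of \<phi> "carrier G" "s \<otimes> y" y] sG y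
      by (simp add: isometry_on_def bij_betw_def)
    then have "f (\<phi> (s \<otimes> y) \<otimes> inv \<phi> y) = d (\<phi> (s \<otimes> y)) (\<phi> y)"
      using img by (simp add: d_def w_def)
    also have "\<dots> = d (s \<otimes> y) y"
      using \<phi> sG y by (simp add: isometry_on_def)
    also have "\<dots> = f s"
      using sy sG y by (simp add: d_def w_def m_assoc)
    finally have "\<phi> (s \<otimes> y) \<otimes> inv \<phi> y = s"
      using f_sep[of "\<phi> (s \<otimes> y) \<otimes> inv \<phi> y" s] img sG inv_s by auto
    then show "\<phi> (s \<otimes> y) = s \<otimes> \<phi> y"
      using img sG by (metis inv_solve_right)
  qed

  have "H \<cong> G" if H: "group H" "carrier H = carrier G" "right_translations_isometric H d"
    for H :: "'a monoid"
  proof -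
    have "x \<otimes>\<^bsub>H\<^esub> h = x \<otimes> (\<one> \<otimes>\<^bsub>H\<^esub> h)" if "x \<in> carrier G" "h \<in> carrier G" for x h
    proof (rule rigid[OF _ that(1)])
      show "isometry_on (carrier G) d (\<lambda>x. x \<otimes>\<^bsub>H\<^esub> h)"
        using H that by (simp add: right_translations_isometric_def)
    qed
    from iso_of_common_right_translations[OF group_axioms H(1,2) this] show ?thesis
      unfolding is_iso_def by blast
  qed
  with metric isometric group_axioms show ?thesis
    unfolding natural_group_def by (intro conjI exI[of _ d] allI impI) auto
qed

theorem theorem3:
  fixes G :: "('a, 'b) monoid_scheme"
  assumes "reflection_group G"
    and "carrier G \<lesssim> (UNIV :: real set)"
  shows "natural_group G"
proof -
  from assms(1) obtain S where "group G" "S \<subseteq> carrier G" "\<forall>s\<in>S. reflection G s"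
    "generated_by_products G S"
    by (auto simp: reflection_group_def)
  with assms(2) show ?thesis
    by (intro group.natural_if_generated_by_reflections[of G S]) auto
qed

end
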